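(* Let $K$ be a number field with algebraic closure $\overline{K}$, let $c\in K$, $c\neq 0$, and let $\mathcal{E}$ be the elliptic curve $y^2=x^3+c$ over $K$. Let $\zeta_3,\zeta_5\in\overline{K}$ be primitive $3$-rd and $5$-th roots of unity respectively, and put $$\delta_1:=-\frac{(-132\zeta_3+24)\zeta_5^3+(36\zeta_3+108)\zeta_5^2+(-96\zeta_3-48)\zeta_5-48\zeta_3+116}{5}.$$ Consider the five conditions: (A) $\zeta_3\notin K$; (B1) $\zeta_5+\zeta_5^{-1}\notin K(\zeta_3)$; (B2) $\zeta_5\notin K(\zeta_3,\zeta_5+\zeta_5^{-1})$; (C) $\sqrt[3]{\delta_1 c}\notin K(\zeta_3,\zeta_5)$; (D) $\sqrt{(\delta_1+1)c}\notin K(\zeta_3,\zeta_5)$. Then the possible degrees $d=[K_5:K]$ are the following, where in each case the listed conditions are exactly those that hold: - $d=48$ if (A), (B1), (B2), (C), (D) hold; - $d=24$ if (C) and three among (A), (B1), (B2), (D) hold; - $d=16$ if (A), (B1), (B2), (D) hold; - $d=12$ if (C) and two among (A), (B1), (B2), (D) hold; - $d=8$ if three among (A), (B1), (B2), (D) hold; - $d=6$ if (C) and one among (A), (B1), (B2), (D) hold; - $d=4$ if two among (A), (B1), (B2), (D) hold; - $d=3$ if (C) holds; - $d=2$ if one among (A), (B1), (B2), (D) holds; - $d=1$ if none of the conditions holds.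
   Context: $\mathcal{E}[5]$ denotes the $5$-torsion subgroup of $\mathcal{E}(\overline{K})$, and $K_5:=K(\mathcal{E}[5])$ is the field obtained by adjoining to $K$ the coordinates of all the points of $\mathcal{E}[5]$. The symbols $\sqrt[3]{\delta_1 c}$ and $\sqrt{(\delta_1+1)c}$ denote a fixed cube root and a fixed square root in $\overline{K}$. *)

theory Defs
  imports Complex_Main "HOL-Algebra.Generated_Fields" "HOL-Algebra.Algebraic_Closure_Type"
begin

text \<open>
  Fields are subsets of an ambient type \<open>'a\<close> of class \<^class>\<open>field_char_0\<close>, which plays the role of
  the algebraic closure of the base field. The record \<^const>\<open>ring_of_type_algebra\<close> gives access to
  the library's subfields, generated fields and dimensions.
\<close>

definition number_field :: "'a::field_char_0 set \<Rightarrow> bool" where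
  "number_field K \<longleftrightarrow>
     subfield K ring_of_type_algebra \<and> ring.finite_dimension ring_of_type_algebra \<rat> K"

definition adjoin :: "'a::field_char_0 set \<Rightarrow> 'a set \<Rightarrow> 'a set" where
  "adjoin K S = generate_field ring_of_type_algebra (K \<union> S)"

text \<open>
  \<open>has_degree K L d\<close> says that \<open>[L : K]\<close> is finite and equal to \<open>d\<close>.
\<close>

definition has_degree :: "'a::field_char_0 set \<Rightarrow> 'a set \<Rightarrow> nat \<Rightarrow> bool" where
  "has_degree K L d \<longleftrightarrow> ring.dimension ring_of_type_algebra d K L"

definition primitive_root_of_unity :: "nat \<Rightarrow> 'a::field_char_0 \<Rightarrow> bool" where
  "primitive_root_of_unity n z \<longleftrightarrow> n > 0 \<and> z ^ n = 1 \<and> (\<forall>k. 0 < k \<and> k < n \<longrightarrow> z ^ k \<noteq> 1)"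

text \<open>
  The group of points of a curve \<open>y\<^sup>2 = x\<^sup>3 + a x + b\<close>. The addition formulas do not involve \<open>b\<close> and are
  meaningful on points of the curve: for two such points with \<open>x1 = x2\<close> and \<open>y1 \<noteq> - y2\<close> one has
  \<open>y1 = y2 \<noteq> 0\<close>, so that the slope is that of the tangent line.
\<close>

datatype 'a ec_point = Infinity | Affine 'a 'a

definition ec_points :: "'a::field_char_0 \<Rightarrow> 'a \<Rightarrow> 'a ec_point set" where
  "ec_points a b = insert Infinity {Affine x y | x y. y ^ 2 = x ^ 3 + a * x + b}"

fun ec_add :: "'a::field_char_0 \<Rightarrow> 'a ec_point \<Rightarrow> 'a ec_point \<Rightarrow> 'a ec_point" where
  "ec_add a Infinity Q = Q"
| "ec_add a P Infinity = P"
| "ec_add a (Affine x1 y1) (Affine x2 y2) =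
     (if x1 = x2 \<and> y1 = - y2 then Infinity
      else let m = (if x1 = x2 then (3 * x1 ^ 2 + a) / (2 * y1) else (y2 - y1) / (x2 - x1));
               x3 = m ^ 2 - x1 - x2
           in Affine x3 (m * (x1 - x3) - y1))"

fun ec_mult :: "'a::field_char_0 \<Rightarrow> nat \<Rightarrow> 'a ec_point \<Rightarrow> 'a ec_point" where
  "ec_mult a 0 P = Infinity"
| "ec_mult a (Suc n) P = ec_add a P (ec_mult a n P)"

definition ec_torsion :: "'a::field_char_0 \<Rightarrow> 'a \<Rightarrow> nat \<Rightarrow> 'a ec_point set" where
  "ec_torsion a b n = {P \<in> ec_points a b. ec_mult a n P = Infinity}"

fun ec_coords :: "'a ec_point \<Rightarrow> 'a set" where
  "ec_coords Infinity = {}"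
| "ec_coords (Affine x y) = {x, y}"

definition torsion_field :: "'a::field_char_0 set \<Rightarrow> 'a \<Rightarrow> 'a \<Rightarrow> nat \<Rightarrow> 'a set" where
  "torsion_field K a b n = adjoin K (\<Union>P \<in> ec_torsion a b n. ec_coords P)"

definition delta1 :: "'a::field_char_0 \<Rightarrow> 'a \<Rightarrow> 'a" where
  "delta1 \<zeta>3 \<zeta>5 =
     - (((- 132 * \<zeta>3 + 24) * \<zeta>5 ^ 3 + (36 * \<zeta>3 + 108) * \<zeta>5 ^ 2
         + (- 96 * \<zeta>3 - 48) * \<zeta>5 - 48 * \<zeta>3 + 116) / 5)"

end

theory Submission
  imports Defs
begin

text \<open>
  A point \<open>(x, y)\<close> has order 5 iff \<open>t = x\<^sup>3 / c\<close> is a root of \<open>5 t\<^sup>4 + 380 t\<^sup>3 - 240 t\<^sup>2 - 1600 t - 256\<close>. The four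
  roots are \<open>delta1 \<zeta>3 (\<zeta>5\<^sup>i)\<close>, and up to cubes in \<open>\<rat>(\<zeta>3, \<zeta>5)\<close> they agree, while \<open>t + 1\<close> is the same for all
  of them up to squares. Hence all coordinates of 5-torsion points lie in \<open>K(\<zeta>3, \<zeta>5, s, r)\<close>. Conversely
  \<open>(r, s)\<close> and \<open>(\<zeta>3 r, s)\<close> are 5-torsion points, and \<open>\<zeta>5\<close> is a polynomial in \<open>\<zeta>3\<close> and \<open>r\<^sup>3 / c\<close>. So the
  5-torsion field is the top of the tower that adjoins \<open>\<zeta>3\<close>, \<open>\<zeta>5 + \<zeta>5\<^sup>-\<^sup>1\<close>, \<open>\<zeta>5\<close>, \<open>s\<close>, \<open>r\<close> in turn, with steps of
  degree 1 or 2 and finally 1 or 3. The last step depends only on whether \<open>r\<close> lies in \<open>K(\<zeta>3, \<zeta>5)\<close>, since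
  adjoining \<open>s\<close> creates no new cube roots over a field that contains \<open>\<zeta>3\<close>.
\<close>

section \<open>Subfields and degrees of quadratic and pure cubic extensions\<close>

abbreviation is_subfield :: "'a::field_char_0 set \<Rightarrow> bool" where
  "is_subfield F \<equiv> subfield F ring_of_type_algebra"

section \<open>The ambient field as a ring, and closure properties of its subfields\<close>

lemma ring_of_type_algebra_simps [simp]:
  "carrier (ring_of_type_algebra :: 'a::field ring) = UNIV"
  "\<one>\<^bsub>ring_of_type_algebra\<^esub> = (1 :: 'a)"
  "\<zero>\<^bsub>ring_of_type_algebra\<^esub> = (0 :: 'a)"
  "x \<oplus>\<^bsub>ring_of_type_algebra\<^esub> y = (x + y :: 'a)"
  "x \<otimes>\<^bsub>ring_of_type_algebra\<^esub> y = (x * y :: 'a)"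
  by (simp_all add: ring_of_type_algebra_def)

interpretation type_ring: Ring.ring "ring_of_type_algebra :: 'a::field ring"
  by (rule ring_from_type_algebra)

lemma a_inv_ring_of_type_algebra [simp]:
  "\<ominus>\<^bsub>ring_of_type_algebra\<^esub> x = (- x :: 'a::field)"
  by (rule abelian_group.minus_equality[OF ring.is_abelian_group]) auto

lemma m_inv_ring_of_type_algebra:
  "x \<noteq> 0 \<Longrightarrow> inv\<^bsub>ring_of_type_algebra\<^esub> x = inverse (x :: 'a::field)"
  by (rule monoid.inv_unique'[OF type_ring.monoid_axioms, symmetric]) auto

text \<open>The inverse condition asks for a cofactor with product 1, because in the extensions
  below inverses are obtained by dividing a product of conjugates by the norm.\<close>

lemma is_subfieldI:
  fixes F :: "'a::field_char_0 set"
  assumes "1 \<in> F" "\<And>x. x \<in> F \<Longrightarrow> - x \<in> F"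
    "\<And>x y. x \<in> F \<Longrightarrow> y \<in> F \<Longrightarrow> x + y \<in> F" "\<And>x y. x \<in> F \<Longrightarrow> y \<in> F \<Longrightarrow> x * y \<in> F"
    and inv: "\<And>x. x \<in> F \<Longrightarrow> x \<noteq> 0 \<Longrightarrow> \<exists>y\<in>F. x * y = 1"
  shows "is_subfield F"
proof (rule field.subfieldI'[OF field_from_type_algebra])
  show "subring F ring_of_type_algebra"
    using assms by (intro type_ring.subringI) auto
  fix k assume "k \<in> F - {\<zero>\<^bsub>ring_of_type_algebra\<^esub>}"
  then have k: "k \<in> F" "k \<noteq> 0" by auto
  then obtain y where "y \<in> F" "k * y = 1" using inv by blast
  then show "inv\<^bsub>ring_of_type_algebra\<^esub> k \<in> F"
    using k by (metis m_inv_ring_of_type_algebra inverse_unique)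
qed

context
  fixes F :: "'a::field_char_0 set"
  assumes F: "is_subfield F"
begin

lemma subfield_0: "0 \<in> F"
  and subfield_1: "1 \<in> F"
  and subfield_uminus: "x \<in> F \<Longrightarrow> - x \<in> F"
  and subfield_add: "x \<in> F \<Longrightarrow> y \<in> F \<Longrightarrow> x + y \<in> F"
  and subfield_mult: "x \<in> F \<Longrightarrow> y \<in> F \<Longrightarrow> x * y \<in> F"
  using subringE(2,3,5,6,7)[OF subfieldE(1)[OF F]] by auto

lemma subfield_diff: "x \<in> F \<Longrightarrow> y \<in> F \<Longrightarrow> x - y \<in> F"
  using subfield_add[OF _ subfield_uminus] by fastforce

lemma subfield_inverse: "x \<in> F \<Longrightarrow> inverse x \<in> F"
  using type_ring.subfield_m_inv(1)[OF F, of x] subfield_0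
  by (cases "x = 0") (auto simp: m_inv_ring_of_type_algebra)

lemma subfield_divide: "x \<in> F \<Longrightarrow> y \<in> F \<Longrightarrow> x / y \<in> F"
  by (simp add: divide_inverse subfield_inverse subfield_mult)

text \<open>Mostly used in the contrapositive: when \<open>y\<close> lies outside \<open>F\<close>,
  a product \<open>x * y\<close> with \<open>x\<close> in \<open>F\<close> can lie in
  \<open>F\<close> only for \<open>x = 0\<close>.\<close>

lemma subfield_mult_cancel: "x * y \<in> F \<Longrightarrow> x \<in> F \<Longrightarrow> x \<noteq> 0 \<Longrightarrow> y \<in> F"
  using subfield_divide[of "x * y" x] by simp

lemma subfield_power: "x \<in> F \<Longrightarrow> x ^ n \<in> F"
  by (induction n) (auto intro: subfield_1 subfield_mult)

lemma subfield_numeral: "numeral k \<in> F"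
  by (induction k) (auto simp only: numeral.simps intro: subfield_1 subfield_add)

lemmas subfield_closed = subfield_0 subfield_1 subfield_uminus subfield_add subfield_mult
  subfield_diff subfield_inverse subfield_divide subfield_power subfield_numeral

end

section \<open>Adjunction and degrees\<close>

lemma adjoin_is_subfield: "is_subfield (adjoin F S)"
  unfolding adjoin_def by (rule field.generate_field_is_subfield[OF field_from_type_algebra]) auto

lemma base_subset_adjoin: "F \<subseteq> adjoin F S"
  and subset_adjoin: "S \<subseteq> adjoin F S"
  unfolding adjoin_def by (auto intro: generate_field.incl)

lemma adjoin_minimal: "is_subfield E \<Longrightarrow> F \<subseteq> E \<Longrightarrow> S \<subseteq> E \<Longrightarrow> adjoin F S \<subseteq> E"
  unfolding adjoin_def by (rule field.generate_field_min_subfield1[OF field_from_type_algebra]) auto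

lemma adjoin_eqI:
  assumes "is_subfield E" "F \<subseteq> E" "S \<subseteq> E" "E \<subseteq> adjoin F S"
  shows "adjoin F S = E"
  using adjoin_minimal[OF assms(1-3)] assms(4) by (rule subset_antisym)

lemma adjoin_adjoin: "adjoin (adjoin F S) T = adjoin F (S \<union> T)"
proof (rule adjoin_eqI[OF adjoin_is_subfield])
  show "adjoin F S \<subseteq> adjoin F (S \<union> T)"
    using subset_adjoin[of "S \<union> T" F]
    by (intro adjoin_minimal adjoin_is_subfield base_subset_adjoin) simp
  show "T \<subseteq> adjoin F (S \<union> T)"
    using subset_adjoin[of "S \<union> T" F] by simp
  show "adjoin F (S \<union> T) \<subseteq> adjoin (adjoin F S) T"
  proof (intro adjoin_minimal adjoin_is_subfield Un_least subset_adjoin)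
    show "F \<subseteq> adjoin (adjoin F S) T" "S \<subseteq> adjoin (adjoin F S) T"
      by (rule subset_trans[OF _ base_subset_adjoin], rule base_subset_adjoin subset_adjoin)+
  qed
qed

lemma adjoin_absorb: "is_subfield F \<Longrightarrow> S \<subseteq> F \<Longrightarrow> adjoin F S = F"
  using adjoin_minimal[of F F S] base_subset_adjoin[of F S] by blast

lemma has_degree_refl: "is_subfield F \<Longrightarrow> has_degree F F 1"
  unfolding has_degree_def by (rule type_ring.dimension_one)

text \<open>\<open>E\<close> stands for an \<open>F\<close>-space rather than a field, so that the
  rule can be iterated along a basis \<open>1\<close>, \<open>r\<close>,
  \<open>r ^ 2\<close>.\<close>

lemma has_degree_extend:
  assumes "has_degree F E n" "v \<notin> E"
  shows "has_degree F {a * v + e | a e. a \<in> F \<and> e \<in> E} (Suc n)"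
proof -
  have "type_ring.line_extension F v E = {a * v + e | a e. a \<in> F \<and> e \<in> E}"
    by (rule Set.set_eqI) (simp only: type_ring.line_extension_mem_iff ring_of_type_algebra_simps, blast)
  then show ?thesis
    using type_ring.Suc_dim[of v E n F] assms by (simp add: has_degree_def)
qed

lemma has_degree_trans:
  "\<lbrakk> is_subfield K; is_subfield F; has_degree K F m; has_degree F E n \<rbrakk> \<Longrightarrow> has_degree K E (m * n)"
  unfolding has_degree_def by (rule type_ring.telescopic_base)

section \<open>Quadratic extensions\<close>

lemma adjoin_quadratic:
  fixes s :: "'a::field_char_0"
  assumes F: "is_subfield F" and s: "s \<notin> F" and p: "p \<in> F" "q \<in> F" "s ^ 2 = p * s + q"
  shows "adjoin F {s} = {a * s + b | a b. a \<in> F \<and> b \<in> F}" (is "_ = ?E")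
proof (rule adjoin_eqI)
  note cl = subfield_closed[OF F]
  have memI: "x \<in> ?E" if "x = a * s + b" "a \<in> F" "b \<in> F" for x a b using that by blast
  show "is_subfield ?E"
  proof (rule is_subfieldI)
    show "1 \<in> ?E" by (rule memI[of _ 0 1]) (auto intro: cl)
  next
    fix x assume "x \<in> ?E"
    then obtain a b where x: "x = a * s + b" "a \<in> F" "b \<in> F" by blast
    show "- x \<in> ?E" by (rule memI[of _ "- a" "- b"]) (auto simp: x intro: cl)
    assume "x \<noteq> 0"
    \<comment> \<open>The norm of \<open>x\<close>: the other root of the quadratic is
      \<open>p - s\<close>, which turns \<open>x\<close> into its conjugate
      \<open>b + p * a - a * s\<close>.\<close>
    define N where "N = b ^ 2 + p * a * b - q * a ^ 2"
    have "x * (b + p * a - a * s) = N - a ^ 2 * (s ^ 2 - (p * s + q))"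
      unfolding x(1) N_def by Groebner_Basis.algebra
    then have N: "x * (b + p * a - a * s) = N" using p(3) by simp
    \<comment> \<open>A vanishing norm makes the conjugate vanish; then \<open>a * s\<close> lies in
      \<open>F\<close>, so \<open>a = 0\<close>, and \<open>N = b ^ 2\<close> gives
      \<open>b = 0\<close>, hence \<open>x = 0\<close>.\<close>
    have "N \<noteq> 0"
    proof
      assume "N = 0"
      then have "a * s = b + p * a" using N \<open>x \<noteq> 0\<close> by simp
      moreover have "b + p * a \<in> F" using x(2,3) p(1) by (intro cl)
      ultimately have "a = 0"
        using subfield_mult_cancel[OF F, of a s] s x(2) by auto
      then show False using \<open>N = 0\<close> \<open>x \<noteq> 0\<close> x(1) by (simp add: N_def)
    qed
    then have "x * ((b + p * a - a * s) / N) = 1" using N by simp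
    moreover have "(b + p * a - a * s) / N \<in> ?E"
      by (rule memI[of _ "- a / N" "(b + p * a) / N"])
        (auto simp: N_def add_divide_distrib diff_divide_distrib x p intro!: cl)
    ultimately show "\<exists>y\<in>?E. x * y = 1" by blast
  next
    fix x y assume "x \<in> ?E" "y \<in> ?E"
    then obtain a b a' b' where xy: "x = a * s + b" "y = a' * s + b'"
      and ab: "a \<in> F" "b \<in> F" "a' \<in> F" "b' \<in> F" by blast
    show "x + y \<in> ?E"
      by (rule memI[of _ "a + a'" "b + b'"]) (auto simp: xy ab algebra_simps intro!: cl)
    show "x * y \<in> ?E"
    proof (rule memI[of _ "a * a' * p + a * b' + b * a'" "a * a' * q + b * b'"])
      show "x * y = (a * a' * p + a * b' + b * a') * s + (a * a' * q + b * b')"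
      proof -
        have "x * y = (a * a' * p + a * b' + b * a') * s + (a * a' * q + b * b')
            + a * a' * (s ^ 2 - (p * s + q))"
          unfolding xy by Groebner_Basis.algebra
        then show ?thesis using p(3) by simp
      qed
    qed (auto simp: ab p intro!: cl)
  qed
  show "F \<subseteq> ?E"
  proof
    fix x assume "x \<in> F"
    then show "x \<in> ?E" by (intro memI[of x 0 x]) (auto intro: cl)
  qed
  show "{s} \<subseteq> ?E" using memI[of s 1 0] cl(1,2) by simp
  show "?E \<subseteq> adjoin F {s}"
    using base_subset_adjoin[of F "{s}"] subset_adjoin[of "{s}" F]
    by (auto intro!: subfield_add[OF adjoin_is_subfield] subfield_mult[OF adjoin_is_subfield])
qed

lemma degree_adjoin_quadratic:
  fixes s :: "'a::field_char_0"
  assumes F: "is_subfield F" and p: "p \<in> F" "q \<in> F" "s ^ 2 = p * s + q"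
  shows "has_degree F (adjoin F {s}) (if s \<in> F then 1 else 2)"
proof (cases "s \<in> F")
  case True
  then show ?thesis using adjoin_absorb[OF F] has_degree_refl[OF F] by simp
next
  case False
  then show ?thesis
    using has_degree_extend[OF has_degree_refl[OF F] False]
    by (simp add: adjoin_quadratic[OF F False p] numeral_2_eq_2)
qed

section \<open>Pure cubic extensions of a field containing the cube roots of unity\<close>

lemma cube_eq_imp:
  fixes x y w :: "'a::field"
  assumes "w ^ 2 + w + 1 = 0" and "x ^ 3 = y ^ 3"
  shows "x = y \<or> x = w * y \<or> x = w ^ 2 * y"
proof -
  have "(x - y) * ((x - w * y) * (x - w ^ 2 * y))
      = (x ^ 3 - y ^ 3) - (w ^ 2 + w + 1) * (x ^ 2 * y - w * x * y ^ 2 + (w - 1) * y ^ 3)"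
    by Groebner_Basis.algebra
  then have "(x - y) * ((x - w * y) * (x - w ^ 2 * y)) = 0"
    using assms by simp
  then show ?thesis by auto
qed

context
  fixes F :: "'a::field_char_0 set" and w r :: 'a
  assumes F: "is_subfield F" and w: "w \<in> F" "w ^ 2 + w + 1 = 0" and r: "r \<notin> F" "r ^ 3 \<in> F"
begin

lemma cube_neq: "a \<in> F \<Longrightarrow> r ^ 3 \<noteq> a ^ 3"
  using cube_eq_imp[OF w(2), of r a] r(1) w(1) subfield_mult[OF F] subfield_power[OF F] by blast

text \<open>Multiplying \<open>r ^ 2 = a * r + b\<close> by \<open>r\<close> gives
  \<open>r ^ 3 = (a ^ 2 + b) * r + a * b\<close>. As \<open>r\<close> is outside \<open>F\<close>,
  this forces \<open>b = - (a ^ 2)\<close>, and then \<open>r ^ 3 = (- a) ^ 3\<close> contradicts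
  \<open>cube_neq\<close>.\<close>

lemma cube_root_sq_notin: "r ^ 2 \<notin> {a * r + b | a b. a \<in> F \<and> b \<in> F}"
proof
  note cl = subfield_closed[OF F]
  assume "r ^ 2 \<in> {a * r + b | a b. a \<in> F \<and> b \<in> F}"
  then obtain a b where ab: "r ^ 2 = a * r + b" "a \<in> F" "b \<in> F" by blast
  have "r * (a ^ 2 + b) = r ^ 3 - a * b - (r + a) * (r ^ 2 - (a * r + b))"
    by Groebner_Basis.algebra
  then have "r * (a ^ 2 + b) = r ^ 3 - a * b" using ab(1) by simp
  moreover have "r ^ 3 - a * b \<in> F" "a ^ 2 + b \<in> F"
    using r(2) ab(2,3) by (auto intro!: cl(4-6,9))
  ultimately have "a ^ 2 + b = 0"
    using subfield_mult_cancel[OF F, of "a ^ 2 + b" r] r(1) by (auto simp: mult.commute)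
  moreover have "r ^ 3 = (- a) ^ 3 + (r + a) * ((r ^ 2 - (a * r + b)) + (a ^ 2 + b))"
    by Groebner_Basis.algebra
  ultimately have "r ^ 3 = (- a) ^ 3" using ab(1) by simp
  then show False
    using cube_neq[of "- a"] cl(3) ab(2) by blast
qed

lemma cube_root_independent:
  assumes "a \<in> F" "b \<in> F" "c \<in> F" "a + b * r + c * r ^ 2 = 0"
  shows "a = 0" "b = 0" "c = 0"
proof -
  note cl = subfield_closed[OF F]
  show c: "c = 0"
  proof (rule ccontr)
    assume "c \<noteq> 0"
    then have "r ^ 2 = (c * r ^ 2) / c" by simp
    also have "c * r ^ 2 = 0 - b * r - a" unfolding assms(4)[symmetric] by simp
    finally have "r ^ 2 = (- b / c) * r + (- a / c)" by (simp add: diff_divide_distrib)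
    moreover have "- b / c \<in> F" "- a / c \<in> F" using assms by (auto intro!: cl)
    ultimately show False using cube_root_sq_notin by blast
  qed
  show b: "b = 0"
  proof (rule ccontr)
    assume "b \<noteq> 0"
    moreover have "b * r = - a" using assms(4) c by (simp add: add_eq_0_iff)
    ultimately have "r = - a / b" by (simp add: field_simps)
    moreover have "- a / b \<in> F" using assms by (auto intro!: cl)
    ultimately show False using r(1) by simp
  qed
  show "a = 0" using assms(4) b c by simp
qed

text \<open>The right-hand side is nested in the shape that two applications of
  \<open>has_degree_extend\<close> produce.\<close>

lemma adjoin_cube_root:
  "adjoin F {r} = {c * r ^ 2 + d | c d. c \<in> F \<and> d \<in> {b * r + a | b a. b \<in> F \<and> a \<in> F}}"
  (is "_ = ?E")
proof (rule adjoin_eqI)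
  note cl = subfield_closed[OF F]
  have memI: "x \<in> ?E" if "x = a + b * r + c * r ^ 2" "a \<in> F" "b \<in> F" "c \<in> F" for x a b c
  proof -
    have "x = c * r ^ 2 + (b * r + a)" using that(1) by simp
    then show ?thesis using that(2-) by blast
  qed
  have memE: "\<exists>a\<in>F. \<exists>b\<in>F. \<exists>c\<in>F. x = a + b * r + c * r ^ 2" if "x \<in> ?E" for x
  proof -
    from that obtain a b c where "x = c * r ^ 2 + (b * r + a)" "a \<in> F" "b \<in> F" "c \<in> F" by blast
    moreover from this(1) have "x = a + b * r + c * r ^ 2" by simp
    ultimately show ?thesis by blast
  qed
  define e where "e = r ^ 3"
  have e: "e \<in> F" using r by (simp add: e_def)
  show "is_subfield ?E"
  proof (rule is_subfieldI)
    show "1 \<in> ?E" by (rule memI[of _ 1 0 0]) (auto intro: cl)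
  next
    fix x assume "x \<in> ?E"
    then obtain a b c where x: "x = a + b * r + c * r ^ 2" and abc: "a \<in> F" "b \<in> F" "c \<in> F"
      using memE by blast
    show "- x \<in> ?E" by (rule memI[of _ "- a" "- b" "- c"]) (auto simp: x abc intro: cl)
    assume "x \<noteq> 0"
    \<comment> \<open>\<open>N\<close> is the norm of \<open>x\<close>, and \<open>x'\<close> is the
      product of its two other conjugates, which arise by replacing \<open>r\<close> with
      \<open>w * r\<close> and \<open>w ^ 2 * r\<close>.\<close>
    define N where "N = a ^ 3 + b ^ 3 * e + c ^ 3 * e ^ 2 - 3 * a * b * c * e"
    define x' where "x' = (a ^ 2 - b * c * e) + (c ^ 2 * e - a * b) * r + (b ^ 2 - a * c) * r ^ 2"
    have N: "x * x' = N"
      unfolding x x'_def N_def e_def by Groebner_Basis.algebra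
    have "N \<noteq> 0"
    proof
      assume "N = 0"
      then have "x' = 0" using N \<open>x \<noteq> 0\<close> by simp
      \<comment> \<open>By independence of \<open>1\<close>, \<open>r\<close>, \<open>r ^ 2\<close>
        every coefficient of \<open>x'\<close> vanishes. Together these equations make
        \<open>e\<close> the cube of \<open>b / c\<close>, which \<open>cube_neq\<close>
        excludes.\<close>
      from this[unfolded x'_def] have "a ^ 2 - b * c * e = 0" "c ^ 2 * e - a * b = 0" "b ^ 2 - a * c = 0"
        by - (erule cube_root_independent[rotated 3]; intro cl abc e)+
      then have eqs: "a ^ 2 = b * c * e" "c ^ 2 * e = a * b" "b ^ 2 = a * c" by auto
      have "c \<noteq> 0"
      proof
        assume "c = 0"
        then have "a = 0" "b = 0" using eqs by auto
        then show False using \<open>c = 0\<close> \<open>x \<noteq> 0\<close> x by simp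
      qed
      moreover have "c ^ 3 * e = b ^ 3"
      proof -
        have "c ^ 3 * e = c * (c ^ 2 * e)" by (simp add: eval_nat_numeral)
        also have "\<dots> = b * (a * c)" by (simp add: eqs(2))
        also have "\<dots> = b ^ 3" by (simp add: eqs(3)[symmetric] eval_nat_numeral)
        finally show ?thesis .
      qed
      ultimately have "e = (b / c) ^ 3" by (simp add: field_simps)
      moreover have "b / c \<in> F" using abc by (intro cl)
      ultimately show False using cube_neq[of "b / c"] unfolding e_def by blast
    qed
    then have "x * (x' / N) = 1" using N by simp
    moreover have "x' / N \<in> ?E"
      by (rule memI[of _ "(a ^ 2 - b * c * e) / N" "(c ^ 2 * e - a * b) / N" "(b ^ 2 - a * c) / N"])
        (auto simp: x'_def add_divide_distrib, auto simp: N_def abc e intro!: cl)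
    ultimately show "\<exists>y\<in>?E. x * y = 1" by blast
  next
    fix x y assume "x \<in> ?E" "y \<in> ?E"
    then obtain a b c a' b' c' where
      xy: "x = a + b * r + c * r ^ 2" "y = a' + b' * r + c' * r ^ 2"
      and ab: "a \<in> F" "b \<in> F" "c \<in> F" "a' \<in> F" "b' \<in> F" "c' \<in> F"
      using memE[of x] memE[of y] by blast
    show "x + y \<in> ?E"
      by (rule memI[of _ "a + a'" "b + b'" "c + c'"]) (auto simp: xy ab algebra_simps intro!: cl)
    show "x * y \<in> ?E"
    proof (rule memI[of _ "a * a' + (b * c' + c * b') * e" "a * b' + b * a' + c * c' * e"
          "a * c' + b * b' + c * a'"])
      show "x * y = a * a' + (b * c' + c * b') * e + (a * b' + b * a' + c * c' * e) * r
          + (a * c' + b * b' + c * a') * r ^ 2"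
        unfolding xy e_def by Groebner_Basis.algebra
    qed (auto simp: ab e intro!: cl)
  qed
  show "F \<subseteq> ?E"
  proof
    fix x assume "x \<in> F"
    then show "x \<in> ?E" by (intro memI[of x x 0 0]) (auto intro: cl)
  qed
  show "{r} \<subseteq> ?E" using memI[of r 0 1 0] cl by auto
  note cl' = subfield_closed[OF adjoin_is_subfield[of F "{r}"]]
  show "?E \<subseteq> adjoin F {r}"
    using base_subset_adjoin[of F "{r}"] subset_adjoin[of "{r}" F] by (auto intro!: cl'(4,5,9))
qed

end

text \<open>Since \<open>w\<close> lies in \<open>F\<close>, one cube root of \<open>r ^ 3\<close>
  in \<open>F\<close> brings the others with it, so degree 2 cannot occur.\<close>

lemma degree_adjoin_cube_root:
  fixes w r :: "'a::field_char_0"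
  assumes F: "is_subfield F" and w: "w \<in> F" "w ^ 2 + w + 1 = 0" and r: "r ^ 3 \<in> F"
  shows "has_degree F (adjoin F {r}) (if r \<in> F then 1 else 3)"
proof (cases "r \<in> F")
  case True
  then show ?thesis using adjoin_absorb[OF F] has_degree_refl[OF F] by simp
next
  case False
  have "has_degree F {b * r + a | b a. b \<in> F \<and> a \<in> F} (Suc 1)"
    by (rule has_degree_extend[OF has_degree_refl[OF F] False])
  from has_degree_extend[OF this cube_root_sq_notin[OF F w False r]]
  show ?thesis
    using False by (simp add: adjoin_cube_root[OF F w False r] numeral_3_eq_3)
qed

text \<open>If \<open>r = a + b s\<close> with \<open>b \<noteq> 0\<close>, then the coefficient \<open>3 a\<^sup>2 + b\<^sup>2 s\<^sup>2\<close> of \<open>b s\<close> in \<open>r\<^sup>3\<close>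
  vanishes, and \<open>-3 = (2 w + 1)\<^sup>2\<close> makes \<open>s\<close> an element of \<open>F\<close>.\<close>

lemma cube_root_mem_adjoin_square_root:
  fixes w r s :: "'a::field_char_0"
  assumes F: "is_subfield F" and w: "w \<in> F" "w ^ 2 + w + 1 = 0"
    and r: "r ^ 3 \<in> F" and s: "s ^ 2 \<in> F"
  shows "r \<in> adjoin F {s} \<longleftrightarrow> r \<in> F"
proof (cases "s \<in> F")
  case True
  then show ?thesis using adjoin_absorb[OF F] by simp
next
  case False
  note cl = subfield_closed[OF F]
  have "r \<in> F" if mem: "r \<in> adjoin F {s}"
  proof -
    have "adjoin F {s} = {a * s + b | a b. a \<in> F \<and> b \<in> F}"
      by (rule adjoin_quadratic[OF F False subfield_0[OF F] s]) simp
    with mem have "r \<in> {a * s + b | a b. a \<in> F \<and> b \<in> F}" by simp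
    then obtain a b where ab: "r = b * s + a" "a \<in> F" "b \<in> F" by blast
    have "b = 0"
    proof (rule ccontr)
      assume b: "b \<noteq> 0"
      have "(3 * a ^ 2 * b + b ^ 3 * s ^ 2) * s = r ^ 3 - a ^ 3 - 3 * a * b ^ 2 * s ^ 2"
        unfolding ab(1) by Groebner_Basis.algebra
      moreover have coeff: "3 * a ^ 2 * b + b ^ 3 * s ^ 2 \<in> F"
        and "r ^ 3 - a ^ 3 - 3 * a * b ^ 2 * s ^ 2 \<in> F"
        by (intro r s ab(2,3) cl)+
      ultimately have "(3 * a ^ 2 * b + b ^ 3 * s ^ 2) * s \<in> F" by (simp only:)
      then have "3 * a ^ 2 * b + b ^ 3 * s ^ 2 = 0"
        using False subfield_mult_cancel[OF F _ coeff] by blast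
      moreover have "b * (3 * a ^ 2 + b ^ 2 * s ^ 2) = 3 * a ^ 2 * b + b ^ 3 * s ^ 2"
        by Groebner_Basis.algebra
      ultimately have "b * (3 * a ^ 2 + b ^ 2 * s ^ 2) = 0" by (simp only:)
      then have "3 * a ^ 2 + b ^ 2 * s ^ 2 = 0" using b by (simp only: mult_eq_0_iff simp_thms)
      moreover have "(b * s - (2 * w + 1) * a) * (b * s + (2 * w + 1) * a)
          = (3 * a ^ 2 + b ^ 2 * s ^ 2) - 4 * (w ^ 2 + w + 1) * a ^ 2"
        by Groebner_Basis.algebra
      ultimately have "(b * s - (2 * w + 1) * a) * (b * s + (2 * w + 1) * a) = 0"
        using w(2) by (simp only: mult_zero_left mult_zero_right diff_0_right)
      then have "b * s = (2 * w + 1) * a \<or> b * s = - ((2 * w + 1) * a)"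
        by (simp only: mult_eq_0_iff right_minus_eq eq_neg_iff_add_eq_0)
      moreover have "(2 * w + 1) * a \<in> F" using ab(2) w(1) by (intro cl)
      ultimately have "b * s \<in> F" using cl(3) by (elim disjE) simp_all
      then show False using False subfield_mult_cancel[OF F _ ab(3) b] by blast
    qed
    then show ?thesis using ab by simp
  qed
  then show ?thesis using base_subset_adjoin[of F "{s}"] by blast
qed

section \<open>Points of order five\<close>

lemma ec_add_self_double:
  fixes a x y :: "'a::field_char_0"
  assumes "y \<noteq> 0"
  defines "m \<equiv> (3 * x ^ 2 + a) / (2 * y)"
  shows "ec_add a (Affine x y) (Affine x y)
    = Affine (x - (3 * x - m ^ 2)) (m * (3 * x - m ^ 2) - y)"
proof -
  have "y \<noteq> - y" using assms(1) by (metis add.right_inverse mult_2 mult_eq_0_iff zero_neq_numeral)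
  then show ?thesis by (simp add: Let_def m_def algebra_simps)
qed

text \<open>The multiples \<open>k P\<close> of \<open>P = (x, y)\<close> are written as \<open>(x - d, m d - y)\<close>, with \<open>m\<close> the slope used to
  compute them. In these coordinates adding \<open>P\<close> is \<open>(d, m) \<mapsto> (3 x - d - m'\<^sup>2, m')\<close> with \<open>m' = 2 y / d - m\<close>,
  and \<open>(k + 1) P\<close> is the point at infinity exactly when \<open>d = 0\<close>.\<close>

lemma ec_add_chord:
  fixes a d m x y :: "'a::field_char_0"
  assumes "d \<noteq> 0"
  defines "m' \<equiv> 2 * y / d - m"
  shows "ec_add a (Affine x y) (Affine (x - d) (m * d - y))
    = Affine (x - (3 * x - d - m' ^ 2)) (m' * (3 * x - d - m' ^ 2) - y)"
proof -
  have "(m * d - y - y) / (x - d - x) = m'"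
    using assms(1) by (simp add: m'_def field_simps)
  moreover have "x \<noteq> x - d" using assms(1) by auto
  ultimately show ?thesis by (simp add: Let_def algebra_simps)
qed

text \<open>If \<open>y\<close>, \<open>d1\<close> or \<open>d2\<close> is the first to vanish, then
  \<open>2 P\<close>, \<open>3 P\<close> or \<open>4 P\<close> is the point at infinity and
  \<open>5 P\<close> is \<open>P\<close>, \<open>2 P\<close> or \<open>P\<close>, hence affine.
  Otherwise the quotients are genuine, and \<open>d3 = 0\<close> says that
  \<open>4 P = - P\<close>.\<close>

lemma ec_mult_5_iff:
  fixes x y a :: "'a::field_char_0"
  defines "m1 \<equiv> (3 * x ^ 2 + a) / (2 * y)"
  defines "d1 \<equiv> 3 * x - m1 ^ 2"
  defines "m2 \<equiv> 2 * y / d1 - m1"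
  defines "d2 \<equiv> 3 * x - d1 - m2 ^ 2"
  defines "m3 \<equiv> 2 * y / d2 - m2"
  defines "d3 \<equiv> 3 * x - d2 - m3 ^ 2"
  shows "ec_mult a 5 (Affine x y) = Infinity \<longleftrightarrow> y \<noteq> 0 \<and> d1 \<noteq> 0 \<and> d2 \<noteq> 0 \<and> d3 = 0"
proof -
  let ?P = "Affine x y"
  have mult: "ec_mult a 5 ?P = ec_add a ?P (ec_add a ?P (ec_add a ?P (ec_add a ?P ?P)))"
    by (simp add: numeral_eq_Suc)
  \<comment> \<open>The value \<open>d = 0\<close> describes \<open>- P\<close>, whatever the
    slope.\<close>
  have opp: "ec_add a ?P (Affine (x - 0) (m * 0 - y)) = Infinity" for m by simp
  show ?thesis
  proof (cases "y = 0")
    case True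
    then show ?thesis unfolding mult by simp
  next
    case y: False
    have P2: "ec_add a ?P ?P = Affine (x - d1) (m1 * d1 - y)"
      using ec_add_self_double[OF y] by (simp add: d1_def m1_def)
    show ?thesis
    proof (cases "d1 = 0")
      case True
      then show ?thesis using opp[of m1] P2 by (simp add: mult)
    next
      case d1: False
      have P3: "ec_add a ?P (Affine (x - d1) (m1 * d1 - y)) = Affine (x - d2) (m2 * d2 - y)"
        unfolding d2_def m2_def by (rule ec_add_chord[OF d1])
      show ?thesis
      proof (cases "d2 = 0")
        case True
        then show ?thesis using opp[of m2] P2 P3 y by (simp add: mult del: ec_add.simps(3))
      next
        case d2: False
        have P4: "ec_add a ?P (Affine (x - d2) (m2 * d2 - y)) = Affine (x - d3) (m3 * d3 - y)"
          unfolding d3_def m3_def by (rule ec_add_chord[OF d2])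
        show ?thesis
        proof (cases "d3 = 0")
          case True
          then show ?thesis using opp[of m3] P2 P3 P4 y d1 d2 by (simp add: mult del: ec_add.simps(3))
        next
          case d3: False
          then show ?thesis
            using ec_add_chord[OF d3, of a x y m3] P2 P3 P4 by (simp add: mult del: ec_add.simps(3))
        qed
      qed
    qed
  qed
qed

text \<open>Multiplied by \<open>c ^ 4\<close>, the quartic is the 5-division polynomial of the
  curve, in which \<open>x\<close> occurs only through \<open>x ^ 3\<close>.\<close>

lemma ec_mult_5_iff_quartic:
  fixes x y c t :: "'a::field_char_0"
  assumes curve: "y ^ 2 = x ^ 3 + c" and "c \<noteq> 0" and t: "x ^ 3 = t * c"
  shows "ec_mult 0 5 (Affine x y) = Infinity
    \<longleftrightarrow> 5 * t ^ 4 + 380 * t ^ 3 - 240 * t ^ 2 - 1600 * t - 256 = 0" (is "_ \<longleftrightarrow> ?Q = 0")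
proof -
  \<comment> \<open>The summand \<open>0\<close> is the curve coefficient \<open>a\<close>; with it
    the definitions agree literally with those of \<open>ec_mult_5_iff\<close>.\<close>
  define m1 where "m1 = (3 * x ^ 2 + 0) / (2 * y)"
  define d1 where "d1 = 3 * x - m1 ^ 2"
  define m2 where "m2 = 2 * y / d1 - m1"
  define d2 where "d2 = 3 * x - d1 - m2 ^ 2"
  define m3 where "m3 = 2 * y / d2 - m2"
  define d3 where "d3 = 3 * x - d2 - m3 ^ 2"
  have iff: "ec_mult 0 5 (Affine x y) = Infinity \<longleftrightarrow> y \<noteq> 0 \<and> d1 \<noteq> 0 \<and> d2 \<noteq> 0 \<and> d3 = 0"
    unfolding d3_def m3_def d2_def m2_def d1_def m1_def by (rule ec_mult_5_iff)
  \<comment> \<open>the division polynomials \<open>\<psi>\<^sub>3\<close> and \<open>\<psi>\<^sub>4 / (4 y)\<close>\<close>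
  define p3 where "p3 = 3 * x * (t + 4) * c"
  define p4 where "p4 = (t ^ 2 + 20 * t - 8) * c ^ 2"
  have Y: "y ^ 2 = (t + 1) * c" using curve t by (simp add: algebra_simps)
  \<comment> \<open>The numerator of the slope \<open>m2\<close> over the denominator
    \<open>2 * y * p3\<close>.\<close>
  define q where "q = 16 * y ^ 4 - 3 * x ^ 2 * p3"
  have p3: "p3 = 12 * x * y ^ 2 - 9 * x ^ 4"
  proof -
    have "12 * x * y ^ 2 - 9 * x ^ 4 = 12 * x * y ^ 2 - 9 * x * x ^ 3" by (simp add: eval_nat_numeral)
    then show ?thesis by (simp add: Y t p3_def algebra_simps)
  qed
  \<comment> \<open>In \<open>x * p3 ^ 2\<close>, \<open>p3 ^ 3\<close> and \<open>q\<close> the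
    abscissa enters only through \<open>x ^ 3\<close>, so they are polynomials in \<open>t\<close>
    and \<open>c\<close>. The denominators of \<open>d2\<close> and \<open>d3\<close> are cleared in
    such a way that only these and \<open>y ^ 2\<close> remain.\<close>
  have x_p3: "x * p3 ^ 2 = 9 * t * (t + 4) ^ 2 * c ^ 3"
  proof -
    have "x * p3 ^ 2 = 9 * x ^ 3 * (t + 4) ^ 2 * c ^ 2" unfolding p3_def by Groebner_Basis.algebra
    then show ?thesis unfolding t by Groebner_Basis.algebra
  qed
  have p3_cubed: "p3 ^ 3 = 27 * t * (t + 4) ^ 3 * c ^ 4"
  proof -
    have "p3 ^ 3 = 27 * x ^ 3 * (t + 4) ^ 3 * c ^ 3" unfolding p3_def by Groebner_Basis.algebra
    then show ?thesis unfolding t by Groebner_Basis.algebra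
  qed
  have q: "q = (7 * t ^ 2 - 4 * t + 16) * c ^ 2"
  proof -
    have "q = 16 * (y ^ 2) ^ 2 - 9 * x ^ 3 * (t + 4) * c" unfolding q_def p3_def by Groebner_Basis.algebra
    then show ?thesis unfolding t Y by Groebner_Basis.algebra
  qed
  have d1: "d1 = p3 / (4 * y ^ 2)" if "y \<noteq> 0"
    using that unfolding d1_def m1_def p3
    by (simp add: power_divide divide_simps)
  have m2: "m2 = q / (2 * y * p3)" if "y \<noteq> 0" "p3 \<noteq> 0"
    using that unfolding m2_def d1[OF that(1)] m1_def q_def
    by (simp add: divide_simps) Groebner_Basis.algebra
  have d2: "d2 = 8 * y ^ 2 * p4 / p3 ^ 2" if "y \<noteq> 0" "p3 \<noteq> 0"
  proof -
    have "d2 * (4 * y ^ 2 * p3 ^ 2) = 12 * (x * p3 ^ 2) * y ^ 2 - p3 ^ 3 - q ^ 2"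
      using that unfolding d2_def d1[OF that(1)] m2[OF that]
      by (simp add: power_divide power_mult_distrib divide_simps) Groebner_Basis.algebra
    also have "\<dots> = 32 * (y ^ 2) ^ 2 * p4"
      unfolding x_p3 p3_cubed q Y p4_def by Groebner_Basis.algebra
    finally show ?thesis using that
      by (simp add: divide_simps) Groebner_Basis.algebra
  qed
  have m3: "m3 = (p3 ^ 3 - 2 * p4 * q) / (4 * y * p3 * p4)"
    if "y \<noteq> 0" "p3 \<noteq> 0" "p4 \<noteq> 0"
    using that unfolding m3_def d2[OF that(1,2)] m2[OF that(1,2)]
    by (simp add: divide_simps) Groebner_Basis.algebra
  have d3: "d3 * (16 * y ^ 2 * p4 ^ 2) = ?Q * c ^ 4 * p3" if "y \<noteq> 0" "p3 \<noteq> 0" "p4 \<noteq> 0"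
  proof -
    have "d3 * (16 * y ^ 2 * p4 ^ 2) * p3 ^ 2
        = 48 * (x * p3 ^ 2) * y ^ 2 * p4 ^ 2 - 128 * (y ^ 2) ^ 2 * p4 ^ 3 - (p3 ^ 3 - 2 * p4 * q) ^ 2"
      using that unfolding d3_def d2[OF that(1,2)] m3[OF that]
      by (simp add: power_divide power_mult_distrib divide_simps) Groebner_Basis.algebra
    also have "\<dots> = ?Q * c ^ 4 * p3 ^ 3"
      unfolding x_p3 p3_cubed q Y p4_def by Groebner_Basis.algebra
    also have "\<dots> = ?Q * c ^ 4 * p3 * p3 ^ 2" by (simp add: eval_nat_numeral)
    finally show ?thesis using that by simp
  qed
  show ?thesis
  proof (cases "y \<noteq> 0 \<and> p3 \<noteq> 0 \<and> p4 \<noteq> 0")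
    case True
    then have "d3 = 0 \<longleftrightarrow> ?Q = 0"
      using d3 assms(2) by auto
    then show ?thesis using True iff d1 d2 by simp
  next
    case False
    \<comment> \<open>A vanishing denominator means that the point has order 2, 3 or 4; each
      corresponding value of \<open>t\<close> is shown not to be a root of the quartic.\<close>
    have "?Q \<noteq> 0"
    proof
      assume Q: "?Q = 0"
      from False consider "t = - 1" | "t = 0" | "t = - 4" | "t ^ 2 + 20 * t - 8 = 0"
        using Y t assms(2) by (auto simp: p3_def p4_def eq_neg_iff_add_eq_0)
      then show False
      proof cases
        case 4
        \<comment> \<open>Division of the quartic by \<open>t ^ 2 + 20 * t - 8\<close> with
          remainder: a common root could only be \<open>2 / 5\<close>.\<close>
        have "23328 * (5 * t - 2) = ?Q - (5 * t ^ 2 + 280 * t - 5800) * (t ^ 2 + 20 * t - 8)"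
          by Groebner_Basis.algebra
        then have "5 * t - 2 = 0" unfolding 4 Q by simp
        then have "t = 2 / 5" by (simp add: field_simps)
        from 4[unfolded this] show False by (simp add: power2_eq_square)
      qed (use Q in simp_all)
    qed
    moreover have "\<not> (y \<noteq> 0 \<and> d1 \<noteq> 0 \<and> d2 \<noteq> 0 \<and> d3 = 0)"
      using False d1 d2 by auto
    ultimately show ?thesis using iff by blast
  qed
qed

section \<open>The roots of the 5-division polynomial\<close>

text \<open>The factor \<open>- 5\<close> relative to \<open>delta1\<close> clears the denominator,
  so that the identities below have integer coefficients.\<close>

definition delta_num :: "'a::field_char_0 \<Rightarrow> 'a \<Rightarrow> 'a" where
  "delta_num w z = (- 132 * w + 24) * z ^ 3 + (36 * w + 108) * z ^ 2 + (- 96 * w - 48) * z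
    - 48 * w + 116"

lemma delta1_eq: "delta1 w z = - (delta_num w z / 5)"
  by (simp add: delta1_def delta_num_def)

text \<open>For \<open>t = delta1 w z\<close> these are \<open>- (t + 4) / (3 t)\<close> and \<open>- (t - 8) / (3 (2 w + 1) t)\<close>, the factors by
  which the endomorphism \<open>\<surd>-3 = 2 w + 1\<close> multiplies the coordinates of a point with \<open>x\<^sup>3 = t c\<close>. As an
  element of \<open>\<int>[w] / 5\<close> it has norm \<open>3\<close>, so that it moves \<open>t\<close> as \<open>z \<mapsto> z\<^sup>3\<close> does.\<close>

definition cube_ratio :: "'a::field_char_0 \<Rightarrow> 'a \<Rightarrow> 'a" where
  "cube_ratio w z = 2 + 2 * z - z ^ 3 + w * (2 + 4 * z + 3 * z ^ 2 + z ^ 3)"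

definition square_ratio :: "'a::field_char_0 \<Rightarrow> 'a \<Rightarrow> 'a" where
  "square_ratio w z = - 1 - 4 * z - 4 * z ^ 2 - 2 * z ^ 3 + w * (2 - 2 * z ^ 2 - 2 * z ^ 3)"

context
  fixes w z :: "'a::field_char_0"
  assumes w: "w ^ 2 + w + 1 = 0" and z: "z ^ 4 + z ^ 3 + z ^ 2 + z + 1 = 0"
begin

text \<open>The cofactors of the two cyclotomic polynomials in the identities below are the quotients of the
  divisions by \<open>w\<^sup>2 + w + 1\<close> and \<open>z\<^sup>4 + z\<^sup>3 + z\<^sup>2 + z + 1\<close> in \<open>\<rat>[w, z]\<close>.\<close>

lemma delta_num_power2:
  "delta_num w (z ^ 2) = - 36 * w * z ^ 3 - 132 * w * z ^ 2 - 168 * w * z - 84 * w - 108 * z ^ 3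
    - 156 * z ^ 2 - 84 * z + 8"
proof -
  have "delta_num w (z ^ 2) = - 36 * w * z ^ 3 - 132 * w * z ^ 2 - 168 * w * z - 84 * w - 108 * z ^ 3
    - 156 * z ^ 2 - 84 * z + 8 + (- 132 * w * z ^ 2 + 132 * w * z + 36 * w + 24 * z ^ 2 - 24 * z
    + 108) * (z ^ 4 + z ^ 3 + z ^ 2 + z + 1)"
    unfolding delta_num_def by Groebner_Basis.algebra
  then show ?thesis using w z by simp
qed

lemma delta_num_power3:
  "delta_num w (z ^ 3) = 36 * w * z ^ 3 + 132 * w * z ^ 2 + 168 * w * z + 84 * w - 72 * z ^ 3
    - 24 * z ^ 2 + 84 * z + 92"
proof -
  have "delta_num w (z ^ 3) = 36 * w * z ^ 3 + 132 * w * z ^ 2 + 168 * w * z + 84 * w - 72 * z ^ 3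
    - 24 * z ^ 2 + 84 * z + 92 + (- 132 * w * z ^ 5 + 132 * w * z ^ 4 + 36 * w * z ^ 2
    - 36 * w * z - 132 * w + 24 * z ^ 5 - 24 * z ^ 4 + 108 * z ^ 2 - 108 * z + 24) * (z ^ 4
    + z ^ 3 + z ^ 2 + z + 1)"
    unfolding delta_num_def by Groebner_Basis.algebra
  then show ?thesis using w z by simp
qed

lemma delta_num_power4:
  "delta_num w (z ^ 4) = 132 * w * z ^ 3 - 36 * w * z ^ 2 + 96 * w * z + 48 * w + 156 * z ^ 3
    + 72 * z ^ 2 + 48 * z + 164"
proof -
  have "delta_num w (z ^ 4) = 132 * w * z ^ 3 - 36 * w * z ^ 2 + 96 * w * z + 48 * w + 156 * z ^ 3
    + 72 * z ^ 2 + 48 * z + 164 + (- 132 * w * z ^ 8 + 132 * w * z ^ 7 + 36 * w * z ^ 4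
    - 168 * w * z ^ 3 + 132 * w * z ^ 2 - 96 * w + 24 * z ^ 8 - 24 * z ^ 7 + 108 * z ^ 4
    - 84 * z ^ 3 - 24 * z ^ 2 - 48) * (z ^ 4 + z ^ 3 + z ^ 2 + z + 1)"
    unfolding delta_num_def by Groebner_Basis.algebra
  then show ?thesis using w z by simp
qed

lemma cube_ratio_cubed:
  "cube_ratio w z ^ 3 = 39 * w * z ^ 3 + 165 * w * z ^ 2 + 204 * w * z + 102 * w - 84 * z ^ 3
    - 21 * z ^ 2 + 102 * z + 115"
proof -
  have "cube_ratio w z ^ 3 = 39 * w * z ^ 3 + 165 * w * z ^ 2 + 204 * w * z + 102 * w - 84 * z ^ 3
    - 21 * z ^ 2 + 102 * z + 115 + (w * z ^ 9 + 9 * w * z ^ 8 + 39 * w * z ^ 7 + 105 * w * z ^ 6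
    + 192 * w * z ^ 5 + 246 * w * z ^ 4 + 220 * w * z ^ 3 + 132 * w * z ^ 2 + 48 * w * z + 8 * w
    - 4 * z ^ 9 - 27 * z ^ 8 - 84 * z ^ 7 - 147 * z ^ 6 - 138 * z ^ 5 - 24 * z ^ 4 + 104 * z ^ 3
    + 132 * z ^ 2 + 72 * z + 16) * (w ^ 2 + w + 1) + (6 * w * z ^ 5 + 21 * w * z ^ 4
    + 18 * w * z ^ 3 - 45 * w * z ^ 2 - 126 * w * z - 102 * w + 3 * z ^ 5 + 24 * z ^ 4
    + 63 * z ^ 3 + 63 * z ^ 2 - 27 * z - 123) * (z ^ 4 + z ^ 3 + z ^ 2 + z + 1)"
    unfolding cube_ratio_def by Groebner_Basis.algebra
  then show ?thesis using w z by simp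
qed

lemma square_ratio_squared:
  "square_ratio w z ^ 2 = - 8 * w * z ^ 3 - 32 * w * z ^ 2 - 40 * w * z - 20 * w + 16 * z ^ 3
    + 4 * z ^ 2 - 20 * z - 23"
proof -
  have "square_ratio w z ^ 2 = - 8 * w * z ^ 3 - 32 * w * z ^ 2 - 40 * w * z - 20 * w + 16 * z ^ 3
    + 4 * z ^ 2 - 20 * z - 23 + (4 * z ^ 6 + 8 * z ^ 5 + 4 * z ^ 4 - 8 * z ^ 3 - 8 * z ^ 2
    + 4) * (w ^ 2 + w + 1) + (4 * w * z ^ 2 + 12 * w * z + 12 * w + 8 * z + 20) * (z ^ 4 + z ^ 3
    + z ^ 2 + z + 1)"
    unfolding square_ratio_def by Groebner_Basis.algebra
  then show ?thesis using w z by simp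
qed

lemma delta_num_power3_eq: "delta_num w (z ^ 3) = cube_ratio w z ^ 3 * delta_num w z"
proof -
  have "(39 * w * z ^ 3 + 165 * w * z ^ 2 + 204 * w * z + 102 * w - 84 * z ^ 3 - 21 * z ^ 2 + 102 * z
    + 115) * delta_num w z = 36 * w * z ^ 3 + 132 * w * z ^ 2 + 168 * w * z + 84 * w - 72 * z ^ 3
    - 24 * z ^ 2 + 84 * z + 92 + (- 5148 * z ^ 6 - 20376 * z ^ 5 - 24732 * z ^ 4 - 23832 * z ^ 3
    - 23832 * z ^ 2 - 19584 * z - 4896) * (w ^ 2 + w + 1) + (17172 * w * z ^ 2 + 11124 * w * z
    + 11124 * w + 3132 * z ^ 2 + 7668 * z + 18144) * (z ^ 4 + z ^ 3 + z ^ 2 + z + 1)"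
    unfolding delta_num_def by Groebner_Basis.algebra
  then show ?thesis unfolding delta_num_power3 cube_ratio_cubed using w z by simp
qed

lemma five_minus_delta_num_power3_eq: "5 - delta_num w (z ^ 3) = square_ratio w z ^ 2 * (5 - delta_num w z)"
proof -
  have "(- 8 * w * z ^ 3 - 32 * w * z ^ 2 - 40 * w * z - 20 * w + 16 * z ^ 3 + 4 * z ^ 2 - 20 * z
    - 23) * (5 - delta_num w z) = 5 - (36 * w * z ^ 3 + 132 * w * z ^ 2 + 168 * w * z + 84 * w
    - 72 * z ^ 3 - 24 * z ^ 2 + 84 * z + 92) + (- 1056 * z ^ 6 - 3936 * z ^ 5 - 4896 * z ^ 4
    - 4656 * z ^ 3 - 4656 * z ^ 2 - 3840 * z - 960) * (w ^ 2 + w + 1) + (3360 * w * z ^ 2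
    + 2160 * w * z + 2160 * w + 672 * z ^ 2 + 1440 * z + 3600) * (z ^ 4 + z ^ 3 + z ^ 2 + z + 1)"
    unfolding delta_num_def by Groebner_Basis.algebra
  then show ?thesis unfolding delta_num_power3 square_ratio_squared using w z by simp
qed

text \<open>Pairing \<open>z\<close> with its inverse \<open>z ^ 4\<close> eliminates
  \<open>w\<close> and leaves \<open>z\<close> only in the combination \<open>z ^ 2 + z ^ 3\<close>:
  a quadratic in \<open>T\<close> over Q(sqrt 5).\<close>

lemma delta_num_prod14:
  "(5 * T + delta_num w z) * (5 * T + delta_num w (z ^ 4)) = 900 * z ^ 3 * T + 1440 * z ^ 3
    + 900 * z ^ 2 * T + 1440 * z ^ 2 + 25 * T ^ 2 + 1400 * T + 2320"
proof -
  have "(5 * T + delta_num w z) * (5 * T + (132 * w * z ^ 3 - 36 * w * z ^ 2 + 96 * w * z + 48 * w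
    + 156 * z ^ 3 + 72 * z ^ 2 + 48 * z + 164)) = 900 * z ^ 3 * T + 1440 * z ^ 3 + 900 * z ^ 2 * T
    + 1440 * z ^ 2 + 25 * T ^ 2 + 1400 * T + 2320 + (- 17424 * z ^ 6 + 9504 * z ^ 5
    - 26640 * z ^ 4 - 5760 * z ^ 3 - 5760 * z ^ 2 - 9216 * z - 2304) * (w ^ 2 + w + 1)
    + (21168 * z ^ 2 - 12096 * z + 19008) * (z ^ 4 + z ^ 3 + z ^ 2 + z + 1)"
    unfolding delta_num_def by Groebner_Basis.algebra
  then show ?thesis using w z by (simp add: delta_num_power4)
qed

lemma delta_num_prod23:
  "(5 * T + delta_num w (z ^ 2)) * (5 * T + delta_num w (z ^ 3)) = - 900 * z ^ 3 * T
    - 1440 * z ^ 3 - 900 * z ^ 2 * T - 1440 * z ^ 2 + 25 * T ^ 2 + 500 * T + 880"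
proof -
  have "(5 * T + (- 36 * w * z ^ 3 - 132 * w * z ^ 2 - 168 * w * z - 84 * w - 108 * z ^ 3
    - 156 * z ^ 2 - 84 * z + 8)) * (5 * T + (36 * w * z ^ 3 + 132 * w * z ^ 2 + 168 * w * z
    + 84 * w - 72 * z ^ 3 - 24 * z ^ 2 + 84 * z + 92)) = - 900 * z ^ 3 * T - 1440 * z ^ 3
    - 900 * z ^ 2 * T - 1440 * z ^ 2 + 25 * T ^ 2 + 500 * T + 880 + (- 1296 * z ^ 6 - 9504 * z ^ 5
    - 29520 * z ^ 4 - 50400 * z ^ 3 - 50400 * z ^ 2 - 28224 * z - 7056) * (w ^ 2 + w + 1)
    + (9072 * z ^ 2 + 14256 * z + 6912) * (z ^ 4 + z ^ 3 + z ^ 2 + z + 1)"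
    by Groebner_Basis.algebra
  then show ?thesis using w z by (simp add: delta_num_power2 delta_num_power3)
qed

text \<open>The two quadratics are conjugate, since replacing \<open>z\<close> by
  \<open>z ^ 2\<close> sends \<open>z ^ 2 + z ^ 3\<close> to \<open>- 1 - (z ^ 2 + z ^ 3)\<close>.
  Their product is therefore a norm from Q(sqrt 5) and rational.\<close>

lemma delta_num_prods:
  "(900 * z ^ 3 * T + 1440 * z ^ 3 + 900 * z ^ 2 * T + 1440 * z ^ 2 + 25 * T ^ 2 + 1400 * T
    + 2320) * (- 900 * z ^ 3 * T - 1440 * z ^ 3 - 900 * z ^ 2 * T - 1440 * z ^ 2 + 25 * T ^ 2
    + 500 * T + 880) = 125 * (5 * T ^ 4 + 380 * T ^ 3 - 240 * T ^ 2 - 1600 * T - 256)"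
proof -
  have "(900 * z ^ 3 * T + 1440 * z ^ 3 + 900 * z ^ 2 * T + 1440 * z ^ 2 + 25 * T ^ 2 + 1400 * T
    + 2320) * (- 900 * z ^ 3 * T - 1440 * z ^ 3 - 900 * z ^ 2 * T - 1440 * z ^ 2 + 25 * T ^ 2
    + 500 * T + 880) = 125 * (5 * T ^ 4 + 380 * T ^ 3 - 240 * T ^ 2 - 1600 * T - 256)
    + (- 810000 * z ^ 2 * T ^ 2 - 2592000 * z ^ 2 * T - 2073600 * z ^ 2 - 810000 * z * T ^ 2
    - 2592000 * z * T - 2073600 * z + 810000 * T ^ 2 + 2592000 * T + 2073600) * (z ^ 4 + z ^ 3
    + z ^ 2 + z + 1)"
    by Groebner_Basis.algebra
  then show ?thesis using z by simp
qed

lemma delta_num_squared: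
  "delta_num w z ^ 2 = - 52080 * w * z ^ 3 + 12240 * w * z ^ 2 - 39840 * w * z - 19920 * w
    + 6720 * z ^ 3 + 38880 * z ^ 2 - 19920 * z + 43120"
proof -
  have "delta_num w z ^ 2 = - 52080 * w * z ^ 3 + 12240 * w * z ^ 2 - 39840 * w * z - 19920 * w
    + 6720 * z ^ 3 + 38880 * z ^ 2 - 19920 * z + 43120 + (17424 * z ^ 6 - 9504 * z ^ 5
    + 26640 * z ^ 4 + 5760 * z ^ 3 + 5760 * z ^ 2 + 9216 * z + 2304) * (w ^ 2 + w + 1)
    + (- 23760 * w * z ^ 2 + 6480 * w * z + 6480 * w - 16848 * z ^ 2 + 31536 * z - 31968) * (z ^ 4
    + z ^ 3 + z ^ 2 + z + 1)"
    unfolding delta_num_def by Groebner_Basis.algebra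
  then show ?thesis using w z by simp
qed

lemma delta_num_cubed:
  "delta_num w z ^ 3 = - 19944000 * w * z ^ 3 + 4708800 * w * z ^ 2 - 15235200 * w * z
    - 7617600 * w + 2577600 * z ^ 3 + 14904000 * z ^ 2 - 7617600 * z + 16496000"
proof -
  have "delta_num w z ^ 3 = delta_num w z ^ 2 * delta_num w z" by (simp add: eval_nat_numeral)
  also have "\<dots> = (- 52080 * w * z ^ 3 + 12240 * w * z ^ 2 - 39840 * w * z - 19920 * w + 6720 * z ^ 3
    + 38880 * z ^ 2 - 19920 * z + 43120) * delta_num w z"
    by (simp only: delta_num_squared)
  also have "\<dots> = - 19944000 * w * z ^ 3 + 4708800 * w * z ^ 2 - 15235200 * w * z - 7617600 * w
    + 2577600 * z ^ 3 + 14904000 * z ^ 2 - 7617600 * z + 16496000 + (6874560 * z ^ 6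
    - 3490560 * z ^ 5 + 10699200 * z ^ 4 + 2520000 * z ^ 3 + 2520000 * z ^ 2 + 3824640 * z
    + 956160) * (w ^ 2 + w + 1) + (- 9011520 * w * z ^ 2 + 2280960 * w * z + 2280960 * w
    - 6713280 * z ^ 2 + 11862720 * z - 12450240) * (z ^ 4 + z ^ 3 + z ^ 2 + z + 1)"
    unfolding delta_num_def by Groebner_Basis.algebra
  finally show ?thesis using w z by simp
qed

text \<open>The powers of \<open>delta_num w z\<close> with exponents 0 to 3 form a basis of Q(w, z)
  over Q(w). Solving for \<open>z\<close> gives these coefficients, with 1944000 as a common
  denominator. This recovers \<open>z\<close> from \<open>w\<close> and
  \<open>r ^ 3 / c\<close>.\<close>

lemma zeta5_eq_delta_num:
  "1944000 * z = - 296000 - 204000 * delta_num w z - 3300 * delta_num w z ^ 2 + 10 * delta_num w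
    z ^ 3 + w * (- 2080000 - 84000 * delta_num w z + 21300 * delta_num w z ^ 2 - 55 * delta_num w
    z ^ 3)"
proof -
  have "- 296000 - 204000 * delta_num w z - 3300 * (- 52080 * w * z ^ 3 + 12240 * w * z ^ 2
    - 39840 * w * z - 19920 * w + 6720 * z ^ 3 + 38880 * z ^ 2 - 19920 * z + 43120)
    + 10 * (- 19944000 * w * z ^ 3 + 4708800 * w * z ^ 2 - 15235200 * w * z - 7617600 * w
    + 2577600 * z ^ 3 + 14904000 * z ^ 2 - 7617600 * z + 16496000) + w * (- 2080000
    - 84000 * delta_num w z + 21300 * (- 52080 * w * z ^ 3 + 12240 * w * z ^ 2 - 39840 * w * z
    - 19920 * w + 6720 * z ^ 3 + 38880 * z ^ 2 - 19920 * z + 43120) - 55 * (- 19944000 * w * z ^ 3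
    + 4708800 * w * z ^ 2 - 15235200 * w * z - 7617600 * w + 2577600 * z ^ 3 + 14904000 * z ^ 2
    - 7617600 * z + 16496000)) = 1944000 * z + (- 1296000 * z ^ 3 - 1296000 * z ^ 2 - 2592000 * z
    - 1296000) * (w ^ 2 + w + 1)"
    unfolding delta_num_def by Groebner_Basis.algebra
  then show ?thesis unfolding delta_num_squared delta_num_cubed using w z by simp
qed

lemma delta1_power3:
  "delta1 w (z ^ 3) = cube_ratio w z ^ 3 * delta1 w z"
  unfolding delta1_eq delta_num_power3_eq by simp

lemma delta1_power3_plus_1:
  "delta1 w (z ^ 3) + 1 = square_ratio w z ^ 2 * (delta1 w z + 1)"
proof -
  have *: "delta1 w x + 1 = (5 - delta_num w x) / 5" for x
    by (simp add: delta1_eq diff_divide_distrib)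
  show ?thesis unfolding * five_minus_delta_num_power3_eq by simp
qed

lemma quartic_eq_prod:
  "5 * T ^ 4 + 380 * T ^ 3 - 240 * T ^ 2 - 1600 * T - 256
   = 5 * ((T - delta1 w z) * (T - delta1 w (z ^ 4)) * ((T - delta1 w (z ^ 2)) * (T - delta1 w (z ^ 3))))"
proof -
  have *: "5 * (T - delta1 w x) = 5 * T + delta_num w x" for x
    by (simp add: delta1_eq algebra_simps)
  have "125 * (5 * T ^ 4 + 380 * T ^ 3 - 240 * T ^ 2 - 1600 * T - 256)
    = (5 * (T - delta1 w z)) * (5 * (T - delta1 w (z ^ 4)))
      * ((5 * (T - delta1 w (z ^ 2))) * (5 * (T - delta1 w (z ^ 3))))"
    unfolding * delta_num_prod14 delta_num_prod23 delta_num_prods ..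
  also have "\<dots> = 125 * (5 * ((T - delta1 w z) * (T - delta1 w (z ^ 4))
      * ((T - delta1 w (z ^ 2)) * (T - delta1 w (z ^ 3)))))" by Groebner_Basis.algebra
  finally show ?thesis unfolding mult_cancel_left by simp
qed

end

section \<open>The 5-torsion field\<close>

lemma primitive_root_3_cyclotomic: "primitive_root_of_unity 3 w \<Longrightarrow> w ^ 2 + w + 1 = (0 :: 'a::field_char_0)"
proof -
  assume w: "primitive_root_of_unity 3 w"
  then have "w ^ 1 \<noteq> 1" "w ^ 3 = 1"
    unfolding primitive_root_of_unity_def by (auto dest: spec[of _ 1])
  moreover have "(w - 1) * (w ^ 2 + w + 1) = w ^ 3 - 1" by Groebner_Basis.algebra
  ultimately show ?thesis by simp
qed

lemma primitive_root_5_cyclotomic: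
  "primitive_root_of_unity 5 z \<Longrightarrow> z ^ 4 + z ^ 3 + z ^ 2 + z + 1 = (0 :: 'a::field_char_0)"
proof -
  assume z: "primitive_root_of_unity 5 z"
  then have "z ^ 1 \<noteq> 1" "z ^ 5 = 1"
    unfolding primitive_root_of_unity_def by (auto dest: spec[of _ 1])
  moreover have "(z - 1) * (z ^ 4 + z ^ 3 + z ^ 2 + z + 1) = z ^ 5 - 1" by Groebner_Basis.algebra
  ultimately show ?thesis by simp
qed

text \<open>For curve points with \<open>x ^ 3 = t * c\<close> and \<open>x' ^ 3 = t' * c\<close>,
  the abscissa \<open>x'\<close> is \<open>u * x\<close> up to a cube root of unity, and the
  ordinate is multiplied by \<open>v\<close> up to sign.\<close>

definition delta_conj :: "'a::field_char_0 set \<Rightarrow> 'a \<Rightarrow> 'a \<Rightarrow> bool" where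
  "delta_conj F t t' \<longleftrightarrow> (\<exists>u\<in>F. t' = u ^ 3 * t) \<and> (\<exists>v\<in>F. t' + 1 = v ^ 2 * (t + 1))"

lemma delta_conj_trans:
  assumes "is_subfield F" "delta_conj F t t'" "delta_conj F t' t''"
  shows "delta_conj F t t''"
proof -
  obtain u v u' v' where uv: "u \<in> F" "v \<in> F" "u' \<in> F" "v' \<in> F"
    and "t' = u ^ 3 * t" "t' + 1 = v ^ 2 * (t + 1)" "t'' = u' ^ 3 * t'" "t'' + 1 = v' ^ 2 * (t' + 1)"
    using assms(2,3) unfolding delta_conj_def by blast
  then have "t'' = (u' * u) ^ 3 * t" "t'' + 1 = (v' * v) ^ 2 * (t + 1)"
    by (simp_all only: power_mult_distrib mult.assoc)
  moreover have "u' * u \<in> F" "v' * v \<in> F" using uv by (auto intro: subfield_mult[OF assms(1)])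
  ultimately show ?thesis
    unfolding delta_conj_def by blast
qed

lemma delta_conj_power3:
  fixes w z :: "'a::field_char_0"
  assumes F: "is_subfield F" and "w \<in> F" "z \<in> F"
    and "w ^ 2 + w + 1 = 0" "z ^ 4 + z ^ 3 + z ^ 2 + z + 1 = 0"
  shows "delta_conj F (delta1 w z) (delta1 w (z ^ 3))"
proof -
  have "cube_ratio w z \<in> F" "square_ratio w z \<in> F"
    unfolding cube_ratio_def square_ratio_def using assms(2,3) by (auto intro!: subfield_closed[OF F])
  then show ?thesis
    unfolding delta_conj_def using delta1_power3[OF assms(4,5)] delta1_power3_plus_1[OF assms(4,5)]
    by blast
qed

text \<open>3 is a primitive root modulo 5: repeated cubing takes \<open>z\<close> to
  \<open>z ^ 3\<close>, \<open>z ^ 4\<close>, \<open>z ^ 2\<close>, so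
  \<open>delta_conj_power3\<close> and transitivity reach all four roots.\<close>

lemma delta_conj_powers:
  fixes w z :: "'a::field_char_0"
  assumes F: "is_subfield F" and mem: "w \<in> F" "z \<in> F"
    and w: "w ^ 2 + w + 1 = 0" and z: "z ^ 4 + z ^ 3 + z ^ 2 + z + 1 = 0"
  shows "delta_conj F (delta1 w z) (delta1 w z)" "delta_conj F (delta1 w z) (delta1 w (z ^ 2))"
    "delta_conj F (delta1 w z) (delta1 w (z ^ 3))" "delta_conj F (delta1 w z) (delta1 w (z ^ 4))"
proof -
  have cyclo: "(x ^ 3) ^ 4 + (x ^ 3) ^ 3 + (x ^ 3) ^ 2 + x ^ 3 + 1 = 0"
    if "x ^ 4 + x ^ 3 + x ^ 2 + x + 1 = 0" for x :: 'a
  proof -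
    \<comment> \<open>The cofactor of degree 8 is the 15th cyclotomic polynomial.\<close>
    have "(x ^ 3) ^ 4 + (x ^ 3) ^ 3 + (x ^ 3) ^ 2 + x ^ 3 + 1
        = (x ^ 8 - x ^ 7 + x ^ 5 - x ^ 4 + x ^ 3 - x + 1) * (x ^ 4 + x ^ 3 + x ^ 2 + x + 1)"
      by Groebner_Basis.algebra
    then show ?thesis using that by simp
  qed
  have "z ^ 5 - 1 = (z - 1) * (z ^ 4 + z ^ 3 + z ^ 2 + z + 1)" by Groebner_Basis.algebra
  then have z5: "z ^ 5 = 1" using z by simp
  have "(z ^ 3) ^ 3 = z ^ 5 * z ^ 4" "(z ^ 4) ^ 3 = (z ^ 5) ^ 2 * z ^ 2"
    by (simp_all flip: power_mult power_add)
  then have pow: "(z ^ 3) ^ 3 = z ^ 4" "(z ^ 4) ^ 3 = z ^ 2"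
    by (simp_all only: z5 power_one mult_1_left)
  have mem': "z ^ 3 \<in> F" "z ^ 4 \<in> F" using mem by (auto intro: subfield_power[OF F])
  have z4: "(z ^ 4) ^ 4 + (z ^ 4) ^ 3 + (z ^ 4) ^ 2 + z ^ 4 + 1 = 0"
    using cyclo[OF cyclo[OF z]] unfolding pow(1) .
  show "delta_conj F (delta1 w z) (delta1 w z)"
    unfolding delta_conj_def by (auto intro!: bexI[of _ 1] subfield_1[OF F])
  show c3: "delta_conj F (delta1 w z) (delta1 w (z ^ 3))"
    by (rule delta_conj_power3[OF F mem w z])
  show c4: "delta_conj F (delta1 w z) (delta1 w (z ^ 4))"
    using delta_conj_trans[OF F c3 delta_conj_power3[OF F mem(1) mem'(1) w cyclo[OF z]]]
    unfolding pow .
  show "delta_conj F (delta1 w z) (delta1 w (z ^ 2))"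
    using delta_conj_trans[OF F c4 delta_conj_power3[OF F mem(1) mem'(2) w z4]]
    unfolding pow .
qed

section \<open>Generators of the 5-torsion field and its degree\<close>

context
  fixes c w z r s :: "'a::field_char_0"
  assumes c: "c \<noteq> 0"
    and w: "w ^ 2 + w + 1 = 0" and z: "z ^ 4 + z ^ 3 + z ^ 2 + z + 1 = 0"
    and r: "r ^ 3 = delta1 w z * c" and s: "s ^ 2 = (delta1 w z + 1) * c"
begin

lemma torsion_coords_mem:
  assumes E: "is_subfield E" and mem: "w \<in> E" "z \<in> E" "r \<in> E" "s \<in> E"
    and P: "P \<in> ec_torsion 0 c 5"
  shows "ec_coords P \<subseteq> E"
proof (cases P)
  case (Affine x y)
  then have xy: "y ^ 2 = x ^ 3 + c" "ec_mult 0 5 (Affine x y) = Infinity"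
    using P by (auto simp: ec_torsion_def ec_points_def)
  define t where "t = x ^ 3 / c"
  have t: "x ^ 3 = t * c" using c by (simp add: t_def)
  have "5 * t ^ 4 + 380 * t ^ 3 - 240 * t ^ 2 - 1600 * t - 256 = 0"
    using xy ec_mult_5_iff_quartic[OF xy(1) c t] by simp
  then have "t \<in> {delta1 w z, delta1 w (z ^ 2), delta1 w (z ^ 3), delta1 w (z ^ 4)}"
    unfolding quartic_eq_prod[OF w z] by auto
  then have "delta_conj E (delta1 w z) t"
    using delta_conj_powers[OF E mem(1,2) w z] by blast
  then obtain u v where uv: "u \<in> E" "v \<in> E"
    and tu: "t = u ^ 3 * delta1 w z" and tv: "t + 1 = v ^ 2 * (delta1 w z + 1)"
    unfolding delta_conj_def by blast
  \<comment> \<open>Elements with equal cubes differ by a power of \<open>w\<close>, which lies in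
    \<open>E\<close>, so \<open>x\<close> can be traced back to \<open>u * r\<close>; squares do the
    same for \<open>y\<close> and \<open>v * s\<close>, up to sign.\<close>
  have "x ^ 3 = (u * r) ^ 3"
    unfolding t power_mult_distrib r tu by simp
  then have "x \<in> {u * r, w * (u * r), w ^ 2 * (u * r)}"
    using cube_eq_imp[OF w] by blast
  moreover have "{u * r, w * (u * r), w ^ 2 * (u * r)} \<subseteq> E"
    using uv(1) mem by (auto intro!: subfield_mult[OF E] subfield_power[OF E])
  ultimately have "x \<in> E" by blast
  have "y ^ 2 = (t + 1) * c" by (simp add: xy t algebra_simps)
  then have "y ^ 2 = (v * s) ^ 2"
    unfolding tv power_mult_distrib s by simp
  then have "y \<in> {v * s, - (v * s)}" by (simp add: power2_eq_iff)
  moreover have "{v * s, - (v * s)} \<subseteq> E"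
    using uv(2) mem by (auto intro!: subfield_uminus[OF E] subfield_mult[OF E])
  ultimately have "y \<in> E" by blast
  with \<open>x \<in> E\<close> show ?thesis by (simp add: Affine)
qed simp

text \<open>Stated for every cube root \<open>x\<close> because both \<open>r\<close> and
  \<open>w * r\<close> are used as abscissae: their quotient is \<open>w\<close>.\<close>

lemma torsion_pointI: "x ^ 3 = r ^ 3 \<Longrightarrow> Affine x s \<in> ec_torsion 0 c 5"
proof -
  assume x: "x ^ 3 = r ^ 3"
  have curve: "s ^ 2 = x ^ 3 + c" unfolding s x r by (simp add: algebra_simps)
  moreover have "ec_mult 0 5 (Affine x s) = Infinity"
    unfolding ec_mult_5_iff_quartic[OF curve c x[unfolded r]] quartic_eq_prod[OF w z] by simp
  ultimately show ?thesis by (simp add: ec_torsion_def ec_points_def)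
qed

lemma torsion_field_eq:
  assumes K: "is_subfield K" and "c \<in> K"
  shows "torsion_field K 0 c 5 = adjoin K {w, z, s, r}"
  unfolding torsion_field_def
proof (rule adjoin_eqI)
  show sub: "is_subfield (adjoin K {w, z, s, r})" by (rule adjoin_is_subfield)
  show "K \<subseteq> adjoin K {w, z, s, r}" by (rule base_subset_adjoin)
  show "(\<Union>P\<in>ec_torsion 0 c 5. ec_coords P) \<subseteq> adjoin K {w, z, s, r}"
    using subset_adjoin[of "{w, z, s, r}" K]
    by (intro UN_least torsion_coords_mem[OF sub]) auto
  let ?S = "\<Union>P\<in>ec_torsion 0 c 5. ec_coords P"
  let ?L = "adjoin K ?S"
  have L: "is_subfield ?L" by (rule adjoin_is_subfield)
  note cl = subfield_closed[OF L]
  have coords: "x \<in> ?L" "s \<in> ?L" if "x ^ 3 = r ^ 3" for x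
  proof -
    have "ec_coords (Affine x s) \<subseteq> ?S" using torsion_pointI[OF that] by blast
    then show "x \<in> ?L" "s \<in> ?L" using subset_adjoin[of ?S K] by auto
  qed
  have "w ^ 3 - 1 = (w - 1) * (w ^ 2 + w + 1)" by Groebner_Basis.algebra
  then have "w ^ 3 = 1" using w by simp
  then have mem: "r \<in> ?L" "s \<in> ?L" "w * r \<in> ?L"
    using coords[of r] coords[of "w * r"] by (simp_all add: power_mult_distrib)
  \<comment> \<open>At \<open>T = 0\<close> the quartic takes the value \<open>- 256\<close>, so
    none of its roots is 0 and \<open>r\<close> can be divided out.\<close>
  have "delta1 w z \<noteq> 0"
    using quartic_eq_prod[OF w z, of 0] by auto
  then have "r \<noteq> 0" using r c by auto
  then have wL: "w \<in> ?L"
    using subfield_mult_cancel[OF L, of r w] mem by (simp add: mult.commute)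
  have "c \<in> ?L" using assms(2) base_subset_adjoin[of K ?S] by blast
  have "delta1 w z = r ^ 3 / c" using r c by simp
  then have "delta1 w z \<in> ?L" using mem(1) \<open>c \<in> ?L\<close> by (auto intro!: cl)
  moreover have "delta_num w z = - (5 * delta1 w z)" by (simp add: delta1_eq)
  ultimately have n: "delta_num w z \<in> ?L" by (auto intro!: cl)
  have "1944000 * z \<in> ?L"
    unfolding zeta5_eq_delta_num[OF w z] by (intro cl n wL)
  then have "z \<in> ?L"
    using subfield_mult_cancel[OF L, of 1944000 z] subfield_numeral[OF L] by simp
  moreover have "K \<subseteq> ?L" by (rule base_subset_adjoin)
  ultimately show "adjoin K {w, z, s, r} \<subseteq> ?L"
    using mem wL by (intro adjoin_minimal L) auto
qed

text \<open>\<open>s\<close> is adjoined before \<open>r\<close>, and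
  \<open>cube_root_mem_adjoin_square_root\<close> then brings the test for \<open>r\<close> down to
  K(w, z), the field over which \<open>s\<close> is tested.\<close>

lemma degree_torsion_field:
  assumes K: "is_subfield K" and cK: "c \<in> K"
  shows "has_degree K (torsion_field K 0 c 5)
    ((if w \<in> K then 1 else 2) * (if z + inverse z \<in> adjoin K {w} then 1 else 2)
     * (if z \<in> adjoin K {w, z + inverse z} then 1 else 2)
     * (if s \<in> adjoin K {w, z} then 1 else 2) * (if r \<in> adjoin K {w, z} then 1 else 3))"
proof -
  let ?a = "z + inverse z"
  define K1 where "K1 = adjoin K {w}"
  define K2 where "K2 = adjoin K1 {?a}"
  define K3 where "K3 = adjoin K2 {z}"
  define K4 where "K4 = adjoin K3 {s}"
  define K5 where "K5 = adjoin K4 {r}"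
  have sub: "is_subfield K1" "is_subfield K2" "is_subfield K3" "is_subfield K4"
    by (simp_all add: K1_def K2_def K3_def K4_def adjoin_is_subfield)
  have "z \<noteq> 0" using z by auto
  have K2: "K2 = adjoin K {w, ?a}"
    by (simp add: K2_def K1_def adjoin_adjoin insert_commute)
  \<comment> \<open>Once \<open>z\<close> is present the generator \<open>?a\<close> is redundant,
    so \<open>K3\<close> is K(w, z).\<close>
  have "K3 = adjoin (adjoin K {w, z}) {?a}"
    by (simp add: K3_def K2 adjoin_adjoin insert_commute)
  moreover have "?a \<in> adjoin K {w, z}"
    using subset_adjoin[of "{w, z}" K]
    by (intro subfield_closed[OF adjoin_is_subfield]) auto
  ultimately have K3: "K3 = adjoin K {w, z}"
    by (simp add: adjoin_absorb adjoin_is_subfield)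
  have K5: "torsion_field K 0 c 5 = K5"
    by (simp add: torsion_field_eq[OF K cK] K5_def K4_def K3 adjoin_adjoin insert_commute)
  have "w ^ 2 = - 1 * w + - 1" using w by (simp add: eq_neg_iff_add_eq_0 algebra_simps)
  from degree_adjoin_quadratic[OF K _ _ this]
  have 1: "has_degree K K1 (if w \<in> K then 1 else 2)"
    unfolding K1_def by (simp add: subfield_closed[OF K])
  \<comment> \<open>Dividing the cyclotomic equation by \<open>z ^ 2\<close> leaves the quadratic
    equation of \<open>?a\<close>.\<close>
  have "z ^ 2 * (?a ^ 2 - (- 1 * ?a + 1)) = z ^ 4 + z ^ 3 + z ^ 2 + z + 1"
    using \<open>z \<noteq> 0\<close> by (simp add: field_simps eval_nat_numeral)
  then have "?a ^ 2 = - 1 * ?a + 1" using z \<open>z \<noteq> 0\<close> by simp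
  from degree_adjoin_quadratic[OF sub(1) _ _ this]
  have 2: "has_degree K1 K2 (if ?a \<in> K1 then 1 else 2)"
    unfolding K2_def by (simp add: subfield_closed[OF sub(1)])
  have aK2: "?a \<in> K2" unfolding K2_def using subset_adjoin[of "{?a}" K1] by simp
  have "z ^ 2 = ?a * z + - 1"
    using \<open>z \<noteq> 0\<close> by (simp add: field_simps power2_eq_square)
  from degree_adjoin_quadratic[OF sub(2) aK2 _ this]
  have 3: "has_degree K2 K3 (if z \<in> K2 then 1 else 2)"
    unfolding K3_def by (simp add: subfield_closed[OF sub(2)])
  have "w \<in> K3" "z \<in> K3" unfolding K3 using subset_adjoin[of "{w, z}" K] by auto
  then have "delta1 w z \<in> K3"
    unfolding delta1_def by (intro subfield_closed[OF sub(3)])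
  moreover have "c \<in> K3" unfolding K3 using cK base_subset_adjoin[of K "{w, z}"] by blast
  ultimately have r3: "r ^ 3 \<in> K3" and s2: "s ^ 2 \<in> K3"
    unfolding r s by (auto intro!: subfield_closed[OF sub(3)])
  have 4: "has_degree K3 K4 (if s \<in> K3 then 1 else 2)"
    unfolding K4_def by (rule degree_adjoin_quadratic[OF sub(3) subfield_0[OF sub(3)] s2]) simp
  have "K3 \<subseteq> K4" unfolding K4_def by (rule base_subset_adjoin)
  then have 5: "has_degree K4 K5 (if r \<in> K4 then 1 else 3)"
    unfolding K5_def using \<open>w \<in> K3\<close> r3 by (intro degree_adjoin_cube_root[OF sub(4) _ w]) auto
  have "r \<in> K4 \<longleftrightarrow> r \<in> K3"
    unfolding K4_def by (rule cube_root_mem_adjoin_square_root[OF sub(3) \<open>w \<in> K3\<close> w r3 s2])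
  with has_degree_trans[OF K sub(4) has_degree_trans[OF K sub(3) has_degree_trans[OF K sub(2)
    has_degree_trans[OF K sub(1) 1 2] 3] 4] 5]
  show ?thesis by (simp only: K5 K1_def K2 K3)
qed

end

theorem theorem6p1:
  fixes K K5 :: "'a::field_char_0 set"
    and c \<zeta>3 \<zeta>5 r s :: 'a
    and A B1 B2 C D :: bool
    and n :: nat
  assumes "number_field K"
    and "algebraic_closure (ring_of_type_algebra :: 'a ring) K"
    and "c \<in> K" and "c \<noteq> 0"
    and "primitive_root_of_unity 3 \<zeta>3"
    and "primitive_root_of_unity 5 \<zeta>5"
    and "r ^ 3 = delta1 \<zeta>3 \<zeta>5 * c"
    and "s ^ 2 = (delta1 \<zeta>3 \<zeta>5 + 1) * c"
    and "K5 = torsion_field K 0 c 5"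
    and "A \<longleftrightarrow> \<zeta>3 \<notin> K"
    and "B1 \<longleftrightarrow> \<zeta>5 + inverse \<zeta>5 \<notin> adjoin K {\<zeta>3}"
    and "B2 \<longleftrightarrow> \<zeta>5 \<notin> adjoin K {\<zeta>3, \<zeta>5 + inverse \<zeta>5}"
    and "C \<longleftrightarrow> r \<notin> adjoin K {\<zeta>3, \<zeta>5}"
    and "D \<longleftrightarrow> s \<notin> adjoin K {\<zeta>3, \<zeta>5}"
    and "n = length (filter (\<lambda>b. b) [A, B1, B2, D])"
  shows "(A \<and> B1 \<and> B2 \<and> C \<and> D \<longrightarrow> has_degree K K5 48) \<and>
         (C \<and> n = 3 \<longrightarrow> has_degree K K5 24) \<and>
         (\<not> C \<and> A \<and> B1 \<and> B2 \<and> D \<longrightarrow> has_degree K K5 16) \<and>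
         (C \<and> n = 2 \<longrightarrow> has_degree K K5 12) \<and>
         (\<not> C \<and> n = 3 \<longrightarrow> has_degree K K5 8) \<and>
         (C \<and> n = 1 \<longrightarrow> has_degree K K5 6) \<and>
         (\<not> C \<and> n = 2 \<longrightarrow> has_degree K K5 4) \<and>
         (C \<and> n = 0 \<longrightarrow> has_degree K K5 3) \<and>
         (\<not> C \<and> n = 1 \<longrightarrow> has_degree K K5 2) \<and>
         (\<not> C \<and> n = 0 \<longrightarrow> has_degree K K5 1)"
proof -
  have K: "is_subfield K" using assms(1) by (simp add: number_field_def)
  \<comment> \<open>The product is \<open>2 ^ n\<close>, with a further factor 3 exactly when
    \<open>C\<close> holds; each listed case is a choice of \<open>n\<close> and
    \<open>C\<close>.\<close>
  have deg: "has_degree K K5 ((if \<not> A then 1 else 2) * (if \<not> B1 then 1 else 2)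
      * (if \<not> B2 then 1 else 2) * (if \<not> D then 1 else 2) * (if \<not> C then 1 else 3))"
    using degree_torsion_field[OF assms(4) primitive_root_3_cyclotomic[OF assms(5)] primitive_root_5_cyclotomic[OF assms(6)]
      assms(7,8) K assms(3)]
    unfolding assms(9-14) by (simp only: not_not)
  show ?thesis
    using deg unfolding assms(15) by (cases A; cases B1; cases B2; cases C; cases D; simp)
qed

end
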